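(* Let $X$ be a topological space, and let $X/_{\sim}$ be the set of its connected components. Suppose that there is a topology $\mathscr{T}$ on $X/_{\sim}$, coarser than the quotient topology, such that $(X/_{\sim},\mathscr{T})$ is totally disconnected. Then a subset $\mathscr{C}\subseteq t(X)$ is a connected component of $t(X)$ if and only if $\mathscr{C}$ is of the form $t(C)$ where $C$ is a connected component of $X$.
   Context: For a topological space $X$, $t(X)$ denotes the set of all closed and irreducible (in particular nonempty) subsets $Z$ of $X$. For a closed subset $Y\subseteq X$, $t(Y)$ is identified with the subset $\{Z\in t(X) : Z\subseteq Y\}$ of $t(X)$; the subsets $t(Y)$, for $Y$ closed in $X$, are the closed sets of a topology on $t(X)$, and $t(X)$ is given this topology. (Connected components of $X$ are closed, so $t(C)$ makes sense for a connected component $C$.) The quotient topology on $X/_{\sim}$ is the one induced by the canonical projection $\pi:X\to X/_{\sim}$ sending $x$ to the connected component containing it; "coarser" is meant in the non-strict sense. A space is totally disconnected if it has no nonempty connected subset other than its points. *)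

theory Defs
  imports "HOL-Analysis.Analysis"
begin

definition irreducible_space :: "'a topology \<Rightarrow> bool" where
  "irreducible_space X \<longleftrightarrow>
     topspace X \<noteq> {} \<and>
     (\<forall>A B. closedin X A \<and> closedin X B \<and> topspace X = A \<union> B
            \<longrightarrow> A = topspace X \<or> B = topspace X)"

definition irreduciblein :: "'a topology \<Rightarrow> 'a set \<Rightarrow> bool" where
  "irreduciblein X S \<longleftrightarrow> S \<subseteq> topspace X \<and> irreducible_space (subtopology X S)"

definition tset :: "'a topology \<Rightarrow> 'a set set" where
  "tset X = {Z. closedin X Z \<and> irreduciblein X Z}"

text \<open>For closed \<open>Y\<close>, this is \<open>t(Y)\<close> viewed inside \<open>t(X)\<close>; it agrees with \<open>t\<close> of
  the subspace \<open>Y\<close>, see \<open>tset_subtopology\<close> below.\<close>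

definition tsub :: "'a topology \<Rightarrow> 'a set \<Rightarrow> 'a set set" where
  "tsub X Y = {Z \<in> tset X. Z \<subseteq> Y}"

text \<open>The topology on \<open>t(X)\<close> whose closed sets are the \<open>t(Y)\<close> for \<open>Y\<close> closed in \<open>X\<close>;
  see \<open>closedin_tspace\<close> below.\<close>

definition tspace :: "'a topology \<Rightarrow> 'a set topology" where
  "tspace X = topology (\<lambda>U. \<exists>Y. closedin X Y \<and> U = tset X - tsub X Y)"

definition component_quotient :: "'a topology \<Rightarrow> 'a set topology" where
  "component_quotient X =
     topology (\<lambda>U. U \<subseteq> connected_components_of X \<and>
                   openin X {x \<in> topspace X. connected_component_of_set X x \<in> U})"

definition coarser_topology :: "'a topology \<Rightarrow> 'a topology \<Rightarrow> bool" where
  "coarser_topology S T \<longleftrightarrow>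
     topspace S = topspace T \<and> (\<forall>U. openin S U \<longrightarrow> openin T U)"

definition totally_disconnected_space :: "'a topology \<Rightarrow> bool" where
  "totally_disconnected_space X \<longleftrightarrow>
     (\<forall>S. connectedin X S \<and> S \<noteq> {} \<longrightarrow> (\<exists>x. S = {x}))"

lemma irreduciblein_Un:
  assumes "irreduciblein X Z" "closedin X A" "closedin X B" "Z \<subseteq> A \<union> B"
  shows "Z \<subseteq> A \<or> Z \<subseteq> B"
proof -
  have Z: "Z \<subseteq> topspace X" "topspace (subtopology X Z) = Z"
    using assms(1) by (auto simp: irreduciblein_def)
  have "closedin (subtopology X Z) (Z \<inter> A)" "closedin (subtopology X Z) (Z \<inter> B)"
    using assms(2,3) by (auto simp: closedin_subtopology)
  moreover have "Z = (Z \<inter> A) \<union> (Z \<inter> B)"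
    using assms(4) by auto
  ultimately have "Z \<inter> A = Z \<or> Z \<inter> B = Z"
    using assms(1) Z(2) unfolding irreduciblein_def irreducible_space_def by metis
  then show ?thesis by auto
qed

lemma tsub_Un:
  assumes "closedin X A" "closedin X B"
  shows "tsub X (A \<union> B) = tsub X A \<union> tsub X B"
  using irreduciblein_Un[OF _ assms] by (auto simp: tsub_def tset_def)

lemma istopology_tspace:
  "istopology (\<lambda>U. \<exists>Y. closedin X Y \<and> U = tset X - tsub X Y)"
  unfolding istopology_def
proof (intro conjI allI impI)
  fix S T
  assume "\<exists>Y. closedin X Y \<and> S = tset X - tsub X Y"
    and "\<exists>Y. closedin X Y \<and> T = tset X - tsub X Y"
  then obtain A B where "closedin X A" "closedin X B"
    and "S = tset X - tsub X A" "T = tset X - tsub X B" by blast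
  then have "closedin X (A \<union> B) \<and> S \<inter> T = tset X - tsub X (A \<union> B)"
    by (auto simp: tsub_Un)
  then show "\<exists>Y. closedin X Y \<and> S \<inter> T = tset X - tsub X Y" by blast
next
  fix \<K>
  assume "\<forall>K\<in>\<K>. \<exists>Y. closedin X Y \<and> K = tset X - tsub X Y"
  then obtain Y where Y: "\<And>K. K \<in> \<K> \<Longrightarrow> closedin X (Y K) \<and> K = tset X - tsub X (Y K)"
    by metis
  let ?Y = "topspace X \<inter> \<Inter> (Y ` \<K>)"
  have "closedin X ?Y"
  proof (cases "\<K> = {}")
    case False
    then show ?thesis using Y by (intro closedin_Int closedin_Inter) auto
  qed auto
  moreover have "\<Union>\<K> = (\<Union>K\<in>\<K>. tset X - tsub X (Y K))"
    using Y by blast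
  then have "\<Union>\<K> = tset X - tsub X ?Y"
    by (auto simp: tsub_def tset_def dest: closedin_subset)
  ultimately show "\<exists>Z. closedin X Z \<and> \<Union>\<K> = tset X - tsub X Z" by blast
qed

lemma openin_tspace:
  "openin (tspace X) U \<longleftrightarrow> (\<exists>Y. closedin X Y \<and> U = tset X - tsub X Y)"
  unfolding tspace_def topology_inverse'[OF istopology_tspace] ..

lemma topspace_tspace [simp]: "topspace (tspace X) = tset X"
proof -
  have "tsub X {} = {}"
    by (auto simp: tsub_def tset_def irreduciblein_def irreducible_space_def)
  then have "openin (tspace X) (tset X)"
    unfolding openin_tspace by (intro exI[of _ "{}"]) simp
  then show ?thesis
    using openin_topspace[of "tspace X"] openin_subset[of "tspace X" "tset X"]
    unfolding openin_tspace by blast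
qed

lemma closedin_tspace:
  "closedin (tspace X) F \<longleftrightarrow> (\<exists>Y. closedin X Y \<and> F = tsub X Y)"
proof
  assume "closedin (tspace X) F"
  then obtain Y where Y: "F \<subseteq> tset X" "closedin X Y" "tset X - F = tset X - tsub X Y"
    unfolding closedin_def openin_tspace topspace_tspace by blast
  have "tsub X Y \<subseteq> tset X" by (auto simp: tsub_def)
  with Y have "F = tsub X Y" by blast
  with Y(2) show "\<exists>Y. closedin X Y \<and> F = tsub X Y" by blast
next
  assume "\<exists>Y. closedin X Y \<and> F = tsub X Y"
  then show "closedin (tspace X) F"
    unfolding closedin_def[of "tspace X"] openin_tspace topspace_tspace
    by (auto simp: tsub_def)
qed

lemma tset_subtopology:
  assumes "closedin X Y"
  shows "tset (subtopology X Y) = tsub X Y"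
proof -
  have "closedin (subtopology X Y) Z \<longleftrightarrow> closedin X Z \<and> Z \<subseteq> Y" for Z
    using closedin_closed_subtopology[OF assms] .
  moreover have "subtopology (subtopology X Y) Z = subtopology X Z" if "Z \<subseteq> Y" for Z
    using that by (simp add: subtopology_subtopology inf.absorb2)
  ultimately show ?thesis
    using closedin_subset[OF assms] unfolding tset_def tsub_def irreduciblein_def
    by (auto dest: closedin_subset)
qed

lemma openin_component_quotient:
  "openin (component_quotient X) U \<longleftrightarrow>
     U \<subseteq> connected_components_of X \<and>
     openin X {x \<in> topspace X. connected_component_of_set X x \<in> U}"
proof -
  let ?\<pi> = "connected_component_of_set X"
  have "istopology (\<lambda>U. U \<subseteq> connected_components_of X \<and> openin X {x \<in> topspace X. ?\<pi> x \<in> U})"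
    unfolding istopology_def
  proof (intro conjI allI impI)
    fix S T
    assume "S \<subseteq> connected_components_of X \<and> openin X {x \<in> topspace X. ?\<pi> x \<in> S}"
      and "T \<subseteq> connected_components_of X \<and> openin X {x \<in> topspace X. ?\<pi> x \<in> T}"
    moreover have "{x \<in> topspace X. ?\<pi> x \<in> S \<inter> T} =
        {x \<in> topspace X. ?\<pi> x \<in> S} \<inter> {x \<in> topspace X. ?\<pi> x \<in> T}" by auto
    ultimately show "S \<inter> T \<subseteq> connected_components_of X"
      "openin X {x \<in> topspace X. ?\<pi> x \<in> S \<inter> T}" by auto
  next
    fix \<K>
    assume *: "\<forall>K\<in>\<K>. K \<subseteq> connected_components_of X \<and> openin X {x \<in> topspace X. ?\<pi> x \<in> K}"
    then show "\<Union>\<K> \<subseteq> connected_components_of X" by auto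
    have "{x \<in> topspace X. ?\<pi> x \<in> \<Union>\<K>} = (\<Union>K\<in>\<K>. {x \<in> topspace X. ?\<pi> x \<in> K})" by auto
    then show "openin X {x \<in> topspace X. ?\<pi> x \<in> \<Union>\<K>}" using * by auto
  qed
  then show ?thesis
    unfolding component_quotient_def by (simp only: topology_inverse')
qed

lemma topspace_component_quotient [simp]:
  "topspace (component_quotient X) = connected_components_of X"
proof -
  have "{x \<in> topspace X. connected_component_of_set X x \<in> connected_components_of X} = topspace X"
    by (auto simp: connected_components_of_def)
  then have "openin (component_quotient X) (connected_components_of X)"
    by (simp add: openin_component_quotient)
  then show ?thesis
    using openin_topspace[of "component_quotient X"]
      openin_subset[of "component_quotient X" "connected_components_of X"]
    unfolding openin_component_quotient by blast
qed

lemma quotient_map_component_quotient: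
  "quotient_map X (component_quotient X) (connected_component_of_set X)"
  by (auto simp: quotient_map_def openin_component_quotient connected_components_of_def)

end

theory Submission
  imports Defs
begin

text \<open>An irreducible set is connected, so sending a closed irreducible \<open>Z\<close> to the component of \<open>X\<close>
  containing it defines a map from \<open>t(X)\<close> to the component space. The preimage of \<open>F\<close> is \<open>t\<close> of the
  union of \<open>F\<close>, so this map is continuous for any topology coarser than the quotient topology; if that
  topology is totally disconnected, the map is constant on connected sets, i.e. these lie in some
  \<open>t(C)\<close>. Conversely \<open>t(C)\<close> is connected, since a separation by closed sets \<open>t(A)\<close>, \<open>t(B)\<close> can be
  tested on the closures of points and would separate \<open>C\<close> by \<open>A\<close>, \<open>B\<close>.\<close>

lemma irreduciblein_nonempty: "irreduciblein X S \<Longrightarrow> S \<noteq> {}"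
  by (auto simp: irreduciblein_def irreducible_space_def)

text \<open>Of two closed sets covering an irreducible set, one already contains it, so the other
  cannot meet it disjointly.\<close>

lemma irreduciblein_imp_connectedin:
  assumes "irreduciblein X S"
  shows "connectedin X S"
  unfolding connectedin_closedin
proof (intro conjI notI)
  show "S \<subseteq> topspace X"
    using assms by (auto simp: irreduciblein_def)
  assume "\<exists>A B. closedin X A \<and> closedin X B \<and> S \<subseteq> A \<union> B \<and> A \<inter> B \<inter> S = {} \<and>
    A \<inter> S \<noteq> {} \<and> B \<inter> S \<noteq> {}"
  then show False
    using irreduciblein_Un[OF assms] by blast
qed

text \<open>Of two closed sets covering the closure, one contains \<open>x\<close>, and a closed
  subset of the closure that contains \<open>x\<close> is the whole closure. These generic members
  let points of the space be tested inside \<open>tspace X\<close>.\<close>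

lemma closure_of_singleton_in_tset:
  assumes "x \<in> topspace X"
  shows "X closure_of {x} \<in> tset X"
proof -
  let ?Z = "X closure_of {x}"
  have x: "x \<in> ?Z"
    using assms by (simp add: closure_of_def)
  have sub: "?Z \<subseteq> topspace X"
    by (rule closure_of_subset_topspace)
  have "A = ?Z" if "closedin (subtopology X ?Z) A" "x \<in> A" for A
  proof -
    have "closedin X A" "A \<subseteq> ?Z"
      using that(1) by (simp_all add: closedin_closed_subtopology)
    then show ?thesis
      using that(2) closure_of_minimal[of "{x}" A X] by auto
  qed
  then have "irreduciblein X ?Z"
    unfolding irreduciblein_def irreducible_space_def
    using x sub by (metis Un_iff empty_iff topspace_subtopology_subset)
  then show ?thesis
    by (simp add: tset_def)
qed

lemma connectedin_tsub:
  assumes "closedin X C" "connectedin X C"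
  shows "connectedin (tspace X) (tsub X C)"
  unfolding connectedin_closedin
proof (intro conjI notI)
  show "tsub X C \<subseteq> topspace (tspace X)"
    by (auto simp: tsub_def)
  assume "\<exists>E F. closedin (tspace X) E \<and> closedin (tspace X) F \<and> tsub X C \<subseteq> E \<union> F \<and>
    E \<inter> F \<inter> tsub X C = {} \<and> E \<inter> tsub X C \<noteq> {} \<and> F \<inter> tsub X C \<noteq> {}"
  then obtain A B where cl: "closedin X A" "closedin X B"
    and cover: "tsub X C \<subseteq> tsub X A \<union> tsub X B"
    and disj: "tsub X A \<inter> tsub X B \<inter> tsub X C = {}"
    and ne: "tsub X A \<inter> tsub X C \<noteq> {}" "tsub X B \<inter> tsub X C \<noteq> {}"
    unfolding closedin_tspace by blast
  \<comment> \<open>Sends a point to a member of \<open>tsub X C\<close> and preserves membership in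
    closed sets, so covering and disjointness descend to \<open>C\<close>.\<close>
  have closure_tsub: "X closure_of {x} \<in> tsub X Y \<longleftrightarrow> x \<in> Y"
    if "closedin X Y" "x \<in> C" for x Y
  proof -
    have "x \<in> topspace X"
      using that(2) closedin_subset[OF assms(1)] by auto
    then have "x \<in> X closure_of {x}" "X closure_of {x} \<in> tset X"
      using closure_of_singleton_in_tset by (auto simp: closure_of_def)
    then show ?thesis
      using closure_of_minimal[of "{x}" Y X] that(1) by (auto simp: tsub_def)
  qed
  have "C \<subseteq> A \<union> B"
    using cover closure_tsub cl assms(1) by blast
  moreover have "A \<inter> B \<inter> C = {}"
    using disj closure_tsub cl assms(1) by blast
  \<comment> \<open>Non-emptiness comes directly from the members, which are nonempty sets.\<close>
  moreover have "Y \<inter> C \<noteq> {}" if ne: "tsub X Y \<inter> tsub X C \<noteq> {}" for Y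
  proof -
    obtain Z where "irreduciblein X Z" "Z \<subseteq> Y \<inter> C"
      using ne by (auto simp: tsub_def tset_def)
    then show ?thesis
      using irreduciblein_nonempty[of X Z] by auto
  qed
  note this[OF ne(1)] this[OF ne(2)]
  ultimately show False
    using assms(2) cl unfolding connectedin_closedin by metis
qed

lemma tsub_component_nonempty:
  assumes "C \<in> connected_components_of X"
  shows "tsub X C \<noteq> {}"
proof -
  obtain x where x: "x \<in> C"
    using assms nonempty_connected_components_of by fastforce
  have "closedin X C"
    using assms by (rule closedin_connected_components_of)
  then have "X closure_of {x} \<subseteq> C" "x \<in> topspace X"
    using x closure_of_minimal[of "{x}" C X] closedin_subset by auto
  then show ?thesis
    using closure_of_singleton_in_tset[of x X] by (auto simp: tsub_def)
qed

lemma connected_component_of_set_eq: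
  assumes "C \<in> connected_components_of X" "x \<in> C"
  shows "connected_component_of_set X x = C"
proof -
  obtain y where "C = connected_component_of_set X y"
    using assms(1) by (auto simp: connected_components_of_def)
  then have "connected_component_of X y = connected_component_of X x"
    using assms(2) connected_component_of_equiv[of X y x] by simp
  then show ?thesis
    using \<open>C = _\<close> by simp
qed

text \<open>Existence holds because \<open>Z\<close> is connected, uniqueness because it has a point
  and that point determines its component. This makes the definite description below
  meaningful.\<close>

lemma tset_component:
  assumes "Z \<in> tset X"
  shows "\<exists>!C. C \<in> connected_components_of X \<and> Z \<subseteq> C"
proof -
  have Z: "connectedin X Z" "Z \<noteq> {}"
    using assms irreduciblein_imp_connectedin irreduciblein_nonempty
    by (auto simp: tset_def)
  then obtain z where z: "z \<in> Z" "z \<in> topspace X"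
    using connectedin_subset_topspace by fastforce
  show ?thesis
  proof (rule ex1I)
    show "connected_component_of_set X z \<in> connected_components_of X \<and>
        Z \<subseteq> connected_component_of_set X z"
      using connected_component_of_maximal[OF Z(1) z(1)] z(2)
      by (auto simp: connected_components_of_def)
  next
    fix C assume "C \<in> connected_components_of X \<and> Z \<subseteq> C"
    then show "C = connected_component_of_set X z"
      using z(1) connected_component_of_set_eq[of C X z] by auto
  qed
qed

lemma continuous_map_tset_component:
  assumes "coarser_topology T (component_quotient X)"
  shows "continuous_map (tspace X) T
    (\<lambda>Z. THE C. C \<in> connected_components_of X \<and> Z \<subseteq> C)"
    (is "continuous_map _ _ ?f")
proof -
  have f: "?f Z \<in> connected_components_of X" "Z \<subseteq> ?f Z" if "Z \<in> tset X" for Z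
    using theI'[OF tset_component[OF that]] by auto
  have T: "topspace T = connected_components_of X"
    using assms by (simp add: coarser_topology_def)
  have "closedin (tspace X) {Z \<in> tset X. ?f Z \<in> F}" if F: "closedin T F" for F
  proof -
    \<comment> \<open>The union of the components in \<open>F\<close>, written as a preimage under
      the projection so that its closedness follows from continuity.\<close>
    let ?Y = "{x \<in> topspace X. connected_component_of_set X x \<in> F}"
    have "openin (component_quotient X) (topspace T - F)"
      using F assms unfolding closedin_def coarser_topology_def by blast
    then have "closedin (component_quotient X) F"
      using closedin_subset[OF F] T by (simp add: closedin_def)
    then have Y: "closedin X ?Y"
      using quotient_imp_continuous_map[OF quotient_map_component_quotient[of X]]
      by (auto simp: continuous_map_closedin)
    \<comment> \<open>All points of \<open>Z\<close> project to \<open>?f Z\<close>; the implication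
      from right to left uses that \<open>Z\<close> has a point.\<close>
    have "?f Z \<in> F \<longleftrightarrow> Z \<subseteq> ?Y" if Z: "Z \<in> tset X" for Z
    proof -
      have sub: "Z \<subseteq> topspace X" "Z \<noteq> {}"
        using Z irreduciblein_nonempty by (auto simp: tset_def irreduciblein_def)
      have "connected_component_of_set X x = ?f Z" if "x \<in> Z" for x
        using f[OF Z] that by (intro connected_component_of_set_eq) auto
      then show ?thesis
        using sub by auto
    qed
    then have "{Z \<in> tset X. ?f Z \<in> F} = tsub X ?Y"
      by (auto simp: tsub_def)
    then show ?thesis
      using Y closedin_tspace by blast
  qed
  then show ?thesis
    using f T by (auto simp: continuous_map_closedin)
qed

lemma connectedin_tspace_imp_subset_tsub:
  assumes "coarser_topology T (component_quotient X)" "totally_disconnected_space T"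
    and S: "connectedin (tspace X) S" "S \<noteq> {}"
  shows "\<exists>C\<in>connected_components_of X. S \<subseteq> tsub X C"
proof -
  let ?f = "\<lambda>Z. THE C. C \<in> connected_components_of X \<and> Z \<subseteq> C"
  have "connectedin T (?f ` S)"
    using connectedin_continuous_map_image[OF continuous_map_tset_component[OF assms(1)] S(1)] .
  moreover have "?f ` S \<noteq> {}"
    using S(2) by simp
  ultimately have "\<exists>C. ?f ` S = {C}"
    using assms(2)[unfolded totally_disconnected_space_def, rule_format, of "?f ` S"]
    by simp
  then obtain C where C: "?f ` S = {C}" ..
  have "S \<subseteq> tset X"
    using connectedin_subset_topspace[OF S(1)] by simp
  have "C \<in> connected_components_of X \<and> Z \<subseteq> C \<and> Z \<in> tset X" if "Z \<in> S" for Z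
  proof -
    have Z: "Z \<in> tset X"
      using \<open>S \<subseteq> tset X\<close> that ..
    have "?f Z = C"
      using imageI[OF that, of ?f] C by simp
    then show ?thesis
      using theI'[OF tset_component[OF Z]] Z by simp
  qed
  then have "C \<in> connected_components_of X" "S \<subseteq> tsub X C"
    using S(2) by (auto simp: tsub_def)
  then show ?thesis ..
qed

theorem theorem3p18:
  fixes X :: "'a topology" and \<C> :: "'a set set"
  assumes "\<exists>\<T> :: 'a set topology.
             topspace \<T> = connected_components_of X \<and>
             coarser_topology \<T> (component_quotient X) \<and>
             totally_disconnected_space \<T>"
    and "\<C> \<subseteq> tset X"
  shows "\<C> \<in> connected_components_of (tspace X) \<longleftrightarrow>
         (\<exists>C \<in> connected_components_of X. \<C> = tsub X C)"
proof
  have subset_tsub: "\<exists>C\<in>connected_components_of X. S \<subseteq> tsub X C"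
    if "connectedin (tspace X) S" "S \<noteq> {}" for S
    using assms(1) connectedin_tspace_imp_subset_tsub that by blast
  have conn: "connectedin (tspace X) (tsub X C)" if "C \<in> connected_components_of X" for C
    using that by (intro connectedin_tsub closedin_connected_components_of
      connectedin_connected_components_of)
  have component: "\<exists>C\<in>connected_components_of X. \<D> = tsub X C"
    if \<D>: "\<D> \<in> connected_components_of (tspace X)" for \<D>
  proof -
    have ne: "\<D> \<noteq> {}"
      using \<D> by (rule nonempty_connected_components_of)
    then obtain C where C: "C \<in> connected_components_of X" "\<D> \<subseteq> tsub X C"
      using subset_tsub connectedin_connected_components_of[OF \<D>] by blast
    \<comment> \<open>\<open>tsub X C\<close> is connected and meets \<open>\<D>\<close>, so
      maximality of the component \<open>\<D>\<close> applies.\<close>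
    moreover have "tsub X C \<subseteq> \<D>"
      using connected_components_of_maximal[OF \<D> conn[OF C(1)]] C(2) ne
      by (auto simp: disjnt_def)
    ultimately show ?thesis by blast
  qed
  show "\<exists>C\<in>connected_components_of X. \<C> = tsub X C"
    if "\<C> \<in> connected_components_of (tspace X)"
    using component that .
  assume "\<exists>C\<in>connected_components_of X. \<C> = tsub X C"
  then obtain C where C: "C \<in> connected_components_of X" "\<C> = tsub X C" by blast
  \<comment> \<open>The converse reduces to the direction already shown: the component through a
    member \<open>Z\<close> of \<open>tsub X C\<close> is some \<open>tsub X C'\<close>, and since
    \<open>Z\<close> lies in both \<open>C\<close> and \<open>C'\<close>, these coincide.\<close>
  obtain Z where Z: "Z \<in> tset X" "Z \<subseteq> C"
    using tsub_component_nonempty[OF C(1)] by (auto simp: tsub_def)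
  let ?\<D> = "connected_component_of_set (tspace X) Z"
  have \<D>: "?\<D> \<in> connected_components_of (tspace X)" "Z \<in> ?\<D>"
    using Z(1) by (auto simp: connected_components_of_def connected_component_of_refl)
  obtain C' where C': "C' \<in> connected_components_of X" "?\<D> = tsub X C'"
    using component[OF \<D>(1)] by blast
  then have "Z \<subseteq> C'"
    using \<D>(2) by (auto simp: tsub_def)
  then have "C' = C"
    using tset_component[OF Z(1)] Z(2) C(1) C'(1) by blast
  then show "\<C> \<in> connected_components_of (tspace X)"
    using \<D>(1) C(2) C'(2) by simp
qed

end
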